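(* Let $\mathrm{HLie}_m(\mathfrak{gl}_2(\mathbb{C}))$ be the set of multiplicative Hom-Lie algebra structures on $\mathfrak{gl}_2(\mathbb{C})$, regarded as a subset of $M_4(\mathbb{C})$, and let $I,\mathfrak{p}_1,\mathfrak{p}_2,\mathfrak{p}_3$ be the ideals of $A=\mathbb{C}[x_{ij}\mid 1\le i,j\le 4]$ defined in the context. Then $$\mathrm{HLie}_m(\mathfrak{gl}_2(\mathbb{C}))=\mathcal{V}(I)=\mathcal{V}(\mathfrak{p}_1)\cup\mathcal{V}(\mathfrak{p}_2)\cup\mathcal{V}(\mathfrak{p}_3).$$
   Context: A linear map $D:\mathfrak{g}\to\mathfrak{g}$ on a finite-dimensional complex Lie algebra $\mathfrak{g}$ is a Hom-Lie algebra structure on $\mathfrak{g}$ if $[D(x),[y,z]]+[D(y),[z,x]]+[D(z),[x,y]]=0$ for all $x,y,z\in\mathfrak{g}$; it is multiplicative if moreover $D([x,y])=[D(x),D(y)]$ for all $x,y\in\mathfrak{g}$. $\mathrm{HLie}_m(\mathfrak{g})$ is the set of all multiplicative Hom-Lie algebra structures on $\mathfrak{g}$. Take the basis $e_1=E_{11},\ e_2=E_{12},\ e_3=E_{21},\ e_4=E_{22}$ of $\mathfrak{gl}_2(\mathbb{C})$, where $E_{ij}$ are the matrix units. A linear map $D$ with $D(e_i)=\sum_{j=1}^4 a_{ij}e_j$ is identified with the matrix $(a_{ij})^T\in M_4(\mathbb{C})$, and a polynomial in $A=\mathbb{C}[x_{ij}\mid 1\le i,j\le 4]$ is evaluated at $D$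 by substituting $x_{ij}=a_{ij}$. For an ideal $J$ of $A$, $\mathcal{V}(J)$ is the set of $D$ in $M_4(\mathbb{C})$ with $f(D)=0$ for all $f\in J$. The ideal $I$ is generated by the 23 polynomials: $f_1= x_{11}-x_{44}$, $f_2=x_{23}x_{32}+x_{41}x_{44}-x_{42}x_{43}-(x_{41}^2+x_{41}+x_{44}^2-x_{44})/2$, $f_3= x_{12}+x_{42}$, $f_4= x_{23}x_{41} - x_{23}x_{44} - x_{23} + 2x_{43}^2$, $f_5= x_{13}+x_{43}$, $f_6= x_{23}x_{42} - (x_{41}x_{43} -x_{43}x_{44} +x_{43})/2$, $f_7=x_{14} - x_{41}$, $f_8= x_{32}x_{41} - x_{32}x_{44} - x_{32} + 2x_{42}^2$, $f_9=x_{21} + x_{43}$, $f_{10}= x_{32}x_{43} - (x_{41}x_{42} - x_{42}x_{44} +x_{42})/2$, $f_{11}= x_{22} - x_{33}$, $f_{12}= x_{33}^2+ x_{41}x_{44} - x_{42}x_{43} - (x_{41}^2 -x_{41} +x_{44}^2 +x_{44})/2$, $f_{13}= x_{23}x_{33}+x_{43}^2$, $f_{14}= x_{33}x_{41} - x_{33}x_{44} + x_{33} + 2x_{42}x_{43}$, $f_{15}=x_{24} - x_{43}$, $f_{16}= x_{33}x_{42} -(x_{41}x_{42} - x_{42}x_{44} -x_{42})/2$, $f_{17}= x_{31} + x_{42}$, $f_{18}= x_{33}x_{43} - (x_{41}x_{43} - x_{43}x_{44} -x_{43})/2$, $f_{19}= x_{32}x_{33} + x_{42}^2$, $f_{20}=x_{42}(x_{41}^2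 - 2x_{41}x_{44} + 4x_{42}x_{43} + x_{44}^2 - 1)$, $f_{21}= x_{34} - x_{42}$, $f_{22}=x_{43}(x_{41}^2 - 2x_{41}x_{44} + 4x_{42}x_{43} + x_{44}^2 - 1)$, $f_{23}= x_{41}^3 - 3x_{41}^2x_{44} + 4x_{41}x_{42}x_{43} + 3x_{41}x_{44}^2 - x_{41} - 4x_{42}x_{43}x_{44} - x_{44}^3 + x_{44}$. Put $\alpha=x_{14}-x_{44}$, $\beta=x_{41}-x_{44}$, $g_1=x_{22}-(\beta-1)/2$, $g_2=x_{23}x_{32}+x_{42}x_{43}-(\beta+1)/2$, $g_3=\beta^2+4x_{42}x_{43}-1$. Then $\mathfrak{p}_1=(f_1,\alpha,\beta,x_{12},x_{13},x_{21},x_{22},x_{23},x_{24},x_{31},x_{32},x_{33},x_{34},x_{42},x_{43})$, $\mathfrak{p}_2=(f_1,\alpha+1,\beta+1,x_{12},x_{13},x_{21},x_{22}-1,x_{23},x_{24},x_{31},x_{32},x_{33}-1,x_{34},x_{42},x_{43})$, $\mathfrak{p}_3=(f_1,f_3,f_4,f_5,f_6,f_7,f_8,f_9,f_{10},f_{11},f_{15},f_{17},f_{21},g_1,g_2,g_3)$. *)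

theory Defs
  imports "HOL-Analysis.Analysis" "HOL-Library.Poly_Mapping"
begin

section \<open>Hom-Lie algebra structures\<close>

locale complex_lie_algebra = vector_space scale
  for scale :: "complex \<Rightarrow> 'g::ab_group_add \<Rightarrow> 'g" +
  fixes bracket :: "'g \<Rightarrow> 'g \<Rightarrow> 'g"
  assumes finite_dimensional: "\<exists>B. finite B \<and> span B = UNIV"
    and bracket_linear_right: "Vector_Spaces.linear scale scale (\<lambda>y. bracket x y)"
    and bracket_linear_left: "Vector_Spaces.linear scale scale (\<lambda>x. bracket x y)"
    and bracket_alternating: "bracket x x = 0"
    and jacobi: "bracket x (bracket y z) + bracket y (bracket z x) + bracket z (bracket x y) = 0"
begin

definition HLie :: "('g \<Rightarrow> 'g) set" where
  "HLie = {D. Vector_Spaces.linear scale scale D \<and>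
     (\<forall>x y z. bracket (D x) (bracket y z) + bracket (D y) (bracket z x)
              + bracket (D z) (bracket x y) = 0)}"

definition HLie\<^sub>m :: "('g \<Rightarrow> 'g) set" where
  "HLie\<^sub>m = {D \<in> HLie. \<forall>x y. D (bracket x y) = bracket (D x) (D y)}"

end

section \<open>The Lie algebra of \<open>n \<times> n\<close> matrices\<close>

text \<open>The library's \<open>*s\<close> on \<open>complex^'n^'n\<close> multiplies by elements of \<open>complex^'n\<close>,
  so multiplication by a complex number is introduced here.\<close>

definition mat_scale :: "complex \<Rightarrow> complex^'n^'n \<Rightarrow> complex^'n^'n" where
  "mat_scale c A = (\<chi> i j. c * A $ i $ j)"

definition commutator :: "complex^'n^'n \<Rightarrow> complex^'n^'n \<Rightarrow> complex^'n^'n" where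
  "commutator A B = A ** B - B ** A"

definition mat_unit :: "'n \<Rightarrow> 'n \<Rightarrow> complex^'n^'n" where
  "mat_unit k l = (\<chi> i j. if i = k \<and> j = l then 1 else 0)"

lemma mat_expand: "A = (\<Sum>k\<in>UNIV. \<Sum>l\<in>UNIV. mat_scale (A $ k $ l) (mat_unit k l))"
proof -
  have "(\<Sum>k\<in>UNIV. \<Sum>l\<in>UNIV. mat_scale (A $ k $ l) (mat_unit k l)) $ i $ j = A $ i $ j" for i j
  proof -
    have "(\<Sum>k\<in>UNIV. \<Sum>l\<in>UNIV. mat_scale (A $ k $ l) (mat_unit k l)) $ i $ j
        = (\<Sum>k\<in>UNIV. \<Sum>l\<in>UNIV. if i = k then (if j = l then A $ k $ l else 0) else 0)"
      by (auto simp: mat_scale_def mat_unit_def intro!: sum.cong)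
    also have "\<dots> = (\<Sum>k\<in>UNIV. if i = k then (\<Sum>l\<in>UNIV. if j = l then A $ k $ l else 0) else 0)"
      by (intro sum.cong) auto
    also have "\<dots> = A $ i $ j"
      by simp
    finally show ?thesis .
  qed
  then show ?thesis
    by (simp add: vec_eq_iff)
qed

global_interpretation gl: complex_lie_algebra mat_scale commutator
proof -
  interpret vector_space mat_scale
    by unfold_locales (simp_all add: mat_scale_def vec_eq_iff algebra_simps)
  have scale: "A ** mat_scale c B = mat_scale c (A ** B)"
    "mat_scale c A ** B = mat_scale c (A ** B)" for c and A B :: "complex^'n^'n"
    by (simp_all add: mat_scale_def matrix_matrix_mult_def vec_eq_iff sum_distrib_left mult_ac)
  have distrib: "A ** (B + C) = A ** B + A ** C" "(B + C) ** A = B ** A + C ** A"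
    "A ** (B - C) = A ** B - A ** C" "(B - C) ** A = B ** A - C ** A"
    for A B C :: "complex^'n^'n"
    by (simp_all add: matrix_matrix_mult_def vec_eq_iff algebra_simps sum.distrib sum_subtractf)
  show "complex_lie_algebra mat_scale (commutator :: complex^'n^'n \<Rightarrow> _)"
  proof (unfold_locales, goal_cases)
    case 1
    let ?B = "range (\<lambda>(k, l). mat_unit k l) :: (complex^'n^'n) set"
    have "A \<in> span ?B" for A
    proof (subst mat_expand[of A], intro span_sum span_scale span_base)
      show "mat_unit k l \<in> ?B" for k l by (rule range_eqI[of _ _ "(k, l)"]) simp
    qed
    then have "finite ?B \<and> span ?B = UNIV" by auto
    then show ?case by blast
  qed (simp_all add: commutator_def scale distrib matrix_mul_assoc
         scale_right_diff_distrib)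
qed

section \<open>Linear maps on \<open>gl\<^sub>2\<close> as \<open>4 \<times> 4\<close> matrices\<close>

text \<open>The index type \<open>4\<close> has the elements \<open>1, 2, 3, 4\<close>, where \<open>4 = 0\<close>.\<close>

definition gl2_basis :: "4 \<Rightarrow> complex^2^2" where
  "gl2_basis i = (if i = 1 then mat_unit 1 1 else if i = 2 then mat_unit 1 2
                  else if i = 3 then mat_unit 2 1 else mat_unit 2 2)"

definition as_matrices :: "(complex^2^2 \<Rightarrow> complex^2^2) set \<Rightarrow> (complex^4^4) set" where
  "as_matrices S = {transpose a | a D. D \<in> S \<and>
     (\<forall>i. D (gl2_basis i) = (\<Sum>j\<in>UNIV. mat_scale (a $ i $ j) (gl2_basis j)))}"

section \<open>Polynomials, ideals and their zero sets\<close>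

text \<open>A polynomial maps monomials to coefficients, a monomial maps variables to exponents; the
  ring structure is the convolution product of \<^theory>\<open>HOL-Library.Poly_Mapping\<close>.
  The variable \<open>x\<^sub>i\<^sub>j\<close> is the pair \<open>(i, j)\<close>.\<close>

type_synonym polyA = "(4 \<times> 4 \<Rightarrow>\<^sub>0 nat) \<Rightarrow>\<^sub>0 complex"

definition X :: "4 \<Rightarrow> 4 \<Rightarrow> polyA" where
  "X i j = Poly_Mapping.single (Poly_Mapping.single (i, j) 1) 1"

definition const :: "complex \<Rightarrow> polyA" where
  "const c = Poly_Mapping.single 0 c"

definition poly_eval :: "(4 \<times> 4 \<Rightarrow> complex) \<Rightarrow> polyA \<Rightarrow> complex" where
  "poly_eval v f = (\<Sum>m\<in>Poly_Mapping.keys f. Poly_Mapping.lookup f m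
     * (\<Prod>p\<in>Poly_Mapping.keys m. v p ^ Poly_Mapping.lookup m p))"

text \<open>An ideal of a commutative ring is a submodule of the ring over itself.\<close>

definition ideal_gen :: "polyA set \<Rightarrow> polyA set" where
  "ideal_gen S = module.span (*) S"

text \<open>The matrix \<open>M\<close> of \<open>D\<close> is the transpose of \<open>(a\<^sub>i\<^sub>j)\<close>, and \<open>x\<^sub>i\<^sub>j\<close> is replaced
  by \<open>a\<^sub>i\<^sub>j\<close>, not by the entry of \<open>M\<close> at \<open>(i, j)\<close>.\<close>

definition zero_set :: "polyA set \<Rightarrow> (complex^4^4) set" where
  "zero_set J = {M. \<forall>f\<in>J. poly_eval (\<lambda>(i, j). transpose M $ i $ j) f = 0}"

section \<open>The ideals\<close>

abbreviation half :: polyA where "half \<equiv> const (1/2)"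

definition "f1 = X 1 1 - X 4 4"
definition "f2 = X 2 3 * X 3 2 + X 4 1 * X 4 4 - X 4 2 * X 4 3
  - half * ((X 4 1)^2 + X 4 1 + (X 4 4)^2 - X 4 4)"
definition "f3 = X 1 2 + X 4 2"
definition "f4 = X 2 3 * X 4 1 - X 2 3 * X 4 4 - X 2 3 + 2 * (X 4 3)^2"
definition "f5 = X 1 3 + X 4 3"
definition "f6 = X 2 3 * X 4 2 - half * (X 4 1 * X 4 3 - X 4 3 * X 4 4 + X 4 3)"
definition "f7 = X 1 4 - X 4 1"
definition "f8 = X 3 2 * X 4 1 - X 3 2 * X 4 4 - X 3 2 + 2 * (X 4 2)^2"
definition "f9 = X 2 1 + X 4 3"
definition "f10 = X 3 2 * X 4 3 - half * (X 4 1 * X 4 2 - X 4 2 * X 4 4 + X 4 2)"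
definition "f11 = X 2 2 - X 3 3"
definition "f12 = (X 3 3)^2 + X 4 1 * X 4 4 - X 4 2 * X 4 3
  - half * ((X 4 1)^2 - X 4 1 + (X 4 4)^2 + X 4 4)"
definition "f13 = X 2 3 * X 3 3 + (X 4 3)^2"
definition "f14 = X 3 3 * X 4 1 - X 3 3 * X 4 4 + X 3 3 + 2 * X 4 2 * X 4 3"
definition "f15 = X 2 4 - X 4 3"
definition "f16 = X 3 3 * X 4 2 - half * (X 4 1 * X 4 2 - X 4 2 * X 4 4 - X 4 2)"
definition "f17 = X 3 1 + X 4 2"
definition "f18 = X 3 3 * X 4 3 - half * (X 4 1 * X 4 3 - X 4 3 * X 4 4 - X 4 3)"
definition "f19 = X 3 2 * X 3 3 + (X 4 2)^2"
definition "f20 = X 4 2 * ((X 4 1)^2 - 2 * X 4 1 * X 4 4 + 4 * X 4 2 * X 4 3 + (X 4 4)^2 - 1)"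
definition "f21 = X 3 4 - X 4 2"
definition "f22 = X 4 3 * ((X 4 1)^2 - 2 * X 4 1 * X 4 4 + 4 * X 4 2 * X 4 3 + (X 4 4)^2 - 1)"
definition "f23 = (X 4 1)^3 - 3 * (X 4 1)^2 * X 4 4 + 4 * X 4 1 * X 4 2 * X 4 3
  + 3 * X 4 1 * (X 4 4)^2 - X 4 1 - 4 * X 4 2 * X 4 3 * X 4 4 - (X 4 4)^3 + X 4 4"

definition ideal_I :: "polyA set" where
  "ideal_I = ideal_gen {f1, f2, f3, f4, f5, f6, f7, f8, f9, f10, f11, f12, f13, f14, f15, f16,
     f17, f18, f19, f20, f21, f22, f23}"

definition "poly_\<alpha> = X 1 4 - X 4 4"
definition "poly_\<beta> = X 4 1 - X 4 4"

definition "g1 = X 2 2 - half * (poly_\<beta> - 1)"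
definition "g2 = X 2 3 * X 3 2 + X 4 2 * X 4 3 - half * (poly_\<beta> + 1)"
definition "g3 = poly_\<beta>^2 + 4 * X 4 2 * X 4 3 - 1"

definition ideal_p1 :: "polyA set" where
  "ideal_p1 = ideal_gen {f1, poly_\<alpha>, poly_\<beta>, X 1 2, X 1 3, X 2 1, X 2 2, X 2 3, X 2 4,
     X 3 1, X 3 2, X 3 3, X 3 4, X 4 2, X 4 3}"

definition ideal_p2 :: "polyA set" where
  "ideal_p2 = ideal_gen {f1, poly_\<alpha> + 1, poly_\<beta> + 1, X 1 2, X 1 3, X 2 1, X 2 2 - 1, X 2 3,
     X 2 4, X 3 1, X 3 2, X 3 3 - 1, X 3 4, X 4 2, X 4 3}"

definition ideal_p3 :: "polyA set" where
  "ideal_p3 = ideal_gen {f1, f3, f4, f5, f6, f7, f8, f9, f10, f11, f15, f17, f21, g1, g2, g3}"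

end

theory Submission
  imports Defs
begin

text \<open>
  Write \<open>gl\<^sub>2 = \<complex>1 \<oplus> sl\<^sub>2\<close> and let \<open>D\<close> be a multiplicative Hom-Lie structure. Inserting \<open>x = 1\<close>
  into the Hom-Jacobi identity shows that \<open>D 1\<close> commutes with all commutators, hence is central.
  Multiplicativity gives \<open>D sl\<^sub>2 \<subseteq> [gl\<^sub>2, gl\<^sub>2] = sl\<^sub>2\<close>, so \<open>D\<close> is a scalar on the centre together with a
  Lie algebra endomorphism \<open>\<phi>\<close> of \<open>sl\<^sub>2\<close>. The Hom-Jacobi identity on \<open>sl\<^sub>2\<close> says exactly that \<open>\<phi>\<close> is
  self-adjoint for the trace form. All of these conditions except that \<open>\<phi>\<close> is an endomorphism are
  linear; they are the nine equations \<open>symmetric_shape\<close>, and six parameters of \<open>\<phi>\<close> remain, on which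
  being an endomorphism is the system \<open>sl2_hom\<close>.

  Since \<open>sl\<^sub>2\<close> is simple, \<open>\<phi>\<close> is zero or an automorphism. An automorphism preserves the trace form, so a
  self-adjoint one satisfies \<open>\<phi>\<^sup>2 = 1\<close>: it is the identity or a half-turn in \<open>SO\<^sub>3\<close>, which
  is characterised by its trace \<open>-1\<close>. These three possibilities are the zero sets of \<open>\<pp>\<^sub>1\<close>,
  \<open>\<pp>\<^sub>2\<close> and \<open>\<pp>\<^sub>3\<close>. The lemma \<open>sl2_hom_iff\<close> proves the trichotomy by direct elimination.

  On the algebraic side, a zero set of a generated ideal is the set of common zeros of the generators
  (\<open>zero_set_ideal_gen\<close>). The linear generators of \<open>I\<close> say \<open>symmetric_shape\<close>. The others
  imply the system \<open>sl2_hom\<close> by linear combinations, and conversely vanish on its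
  solutions because they vanish in each of the three cases (\<open>sl2_hom_consequences\<close>). So both
  \<open>HLie\<^sub>m\<close> and \<open>\<V>(I)\<close> are described by \<open>symmetric_shape\<close> and \<open>sl2_hom\<close>.
\<close>

section \<open>Evaluation of polynomials\<close>

definition monom_eval :: "('x \<Rightarrow> complex) \<Rightarrow> ('x \<Rightarrow>\<^sub>0 nat) \<Rightarrow> complex" where
  "monom_eval v m = (\<Prod>p\<in>Poly_Mapping.keys m. v p ^ Poly_Mapping.lookup m p)"

lemma monom_eval_superset:
  assumes "finite K" "Poly_Mapping.keys m \<subseteq> K"
  shows "monom_eval v m = (\<Prod>p\<in>K. v p ^ Poly_Mapping.lookup m p)"
  unfolding monom_eval_def using assms
  by (intro prod.mono_neutral_left) (auto simp: in_keys_iff)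

lemma monom_eval_add: "monom_eval v (m + n) = monom_eval v m * monom_eval v n"
proof -
  let ?K = "Poly_Mapping.keys m \<union> Poly_Mapping.keys n"
  have "Poly_Mapping.keys (m + n) \<subseteq> ?K"
    by (rule keys_add)
  then show ?thesis
    by (simp add: monom_eval_superset[of ?K] lookup_add power_add prod.distrib)
qed

lemma poly_eval_alt:
  "poly_eval v f = (\<Sum>m\<in>Poly_Mapping.keys f. Poly_Mapping.lookup f m * monom_eval v m)"
  by (simp add: poly_eval_def monom_eval_def)

lemma poly_eval_zero [simp]: "poly_eval v 0 = 0"
  by (simp add: poly_eval_def)

lemma poly_eval_add [simp]: "poly_eval v (f + g) = poly_eval v f + poly_eval v g"
  unfolding poly_eval_alt
  by (rule setsum_keys_plus_distrib) (simp_all add: algebra_simps)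

lemma poly_eval_single: "poly_eval v (Poly_Mapping.single m c) = c * monom_eval v m"
  by (simp add: poly_eval_alt)

text \<open>Adding one monomial at a time replaces the double convolution sum in the proof of
  multiplicativity by two inductions.\<close>

lemma polynomial_induct [case_names zero monomial]:
  fixes f :: "'m \<Rightarrow>\<^sub>0 'c::monoid_add"
  assumes "P 0" "\<And>f m c. P f \<Longrightarrow> P (f + Poly_Mapping.single m c)"
  shows "P f"
proof (induction f rule: update_induct)
  case (update f m c)
  have "Poly_Mapping.update m c f = f + Poly_Mapping.single m c"
    using update.hyps
    by (intro poly_mapping_eqI) (auto simp: lookup_update lookup_add lookup_single when_def in_keys_iff)
  then show ?case using assms(2) update.IH by simp
qed (rule assms)

lemma poly_eval_mult [simp]: "poly_eval v (f * g) = poly_eval v f * poly_eval v g"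
proof (induction f rule: polynomial_induct)
  case (monomial f m c)
  have "poly_eval v (Poly_Mapping.single m c * g) = c * monom_eval v m * poly_eval v g"
    by (induction g rule: polynomial_induct)
       (simp_all add: distrib_left mult_single poly_eval_single monom_eval_add)
  with monomial show ?case
    by (simp add: distrib_right poly_eval_single)
qed simp

lemma poly_eval_const [simp]: "poly_eval v (const c) = c"
  by (simp add: const_def poly_eval_single monom_eval_def)

lemma poly_eval_one [simp]: "poly_eval v 1 = 1"
  using poly_eval_const[of v 1] by (simp add: const_def)

lemma poly_eval_diff [simp]: "poly_eval v (f - g) = poly_eval v f - poly_eval v g"
  using poly_eval_add[of v "f - g" g] by (simp del: poly_eval_add)

lemma poly_eval_numeral [simp]: "poly_eval v (numeral n) = numeral n"
  by (induction n) (simp_all only: numeral.simps poly_eval_add poly_eval_one)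

lemma poly_eval_power [simp]: "poly_eval v (f ^ n) = poly_eval v f ^ n"
  by (induction n) simp_all

lemma poly_eval_X [simp]: "poly_eval v (X i j) = v (i, j)"
  by (simp add: X_def poly_eval_single monom_eval_def)

text \<open>The polynomials that vanish at a fixed point form an ideal, so they contain the ideal generated
  by any set of them.\<close>

lemma zero_set_ideal_gen:
  "M \<in> zero_set (ideal_gen S)
    \<longleftrightarrow> (\<forall>f\<in>S. poly_eval (\<lambda>(i, j). transpose M $ i $ j) f = 0)"
    (is "_ \<longleftrightarrow> (\<forall>f\<in>S. ?ev f = 0)")
proof -
  interpret module "(*) :: polyA \<Rightarrow> polyA \<Rightarrow> polyA"
    by unfold_locales (simp_all add: algebra_simps)
  have "subspace {f. ?ev f = 0}"
    by (simp add: subspace_def)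
  then have "span S \<subseteq> {f. ?ev f = 0}" if "\<forall>f\<in>S. ?ev f = 0"
    using that by (intro span_minimal) auto
  then show ?thesis
    unfolding zero_set_def ideal_gen_def using span_base by blast
qed

section \<open>Endomorphisms of the Lie algebra of traceless matrices\<close>

text \<open>Let \<open>h = e\<^sub>1 - e\<^sub>4\<close>. The maps of \<open>sl\<^sub>2\<close> that are self-adjoint for the trace form are
  \<open>h \<mapsto> -\<beta> h - 2 p e\<^sub>2 - 2 q e\<^sub>3\<close>, \<open>e\<^sub>2 \<mapsto> -q h + s e\<^sub>2 + t e\<^sub>3\<close>, \<open>e\<^sub>3 \<mapsto> -p h + u e\<^sub>2 + s e\<^sub>3\<close>. Comparing
  coefficients in \<open>[\<phi> e\<^sub>2, \<phi> e\<^sub>3] = \<phi> h\<close>, \<open>[\<phi> h, \<phi> e\<^sub>2] = 2 \<phi> e\<^sub>2\<close> and \<open>[\<phi> e\<^sub>3, \<phi> h] = 2 \<phi> e\<^sub>3\<close> gives the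
  equations below. The sign of \<open>\<beta>\<close> agrees with the \<open>\<beta> = x\<^sub>4\<^sub>1 - x\<^sub>4\<^sub>4\<close> of the ideals.\<close>

definition sl2_hom :: "complex \<Rightarrow> complex \<Rightarrow> complex \<Rightarrow> complex \<Rightarrow> complex \<Rightarrow> complex \<Rightarrow> bool" where
  "sl2_hom \<beta> p q s t u \<longleftrightarrow>
     t * u = s\<^sup>2 + \<beta> \<and> q * u = p * (s + 1) \<and> p * t = q * (s + 1) \<and>
     s * (\<beta> + 1) = - 2 * p * q \<and> t * (1 - \<beta>) = 2 * q\<^sup>2 \<and> u * (1 - \<beta>) = 2 * p\<^sup>2"

text \<open>The half-turns: \<open>2 s = \<beta> - 1\<close> says that the trace \<open>2 s - \<beta>\<close> is \<open>-1\<close>. The remaining equations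
  are the ones that the quadratic generators of \<open>\<pp>\<^sub>3\<close> impose.\<close>

definition sl2_involution ::
    "complex \<Rightarrow> complex \<Rightarrow> complex \<Rightarrow> complex \<Rightarrow> complex \<Rightarrow> complex \<Rightarrow> bool" where
  "sl2_involution \<beta> p q s t u \<longleftrightarrow>
     2 * s = \<beta> - 1 \<and> \<beta>\<^sup>2 + 4 * p * q = 1 \<and> 2 * (t * u + p * q) = \<beta> + 1 \<and>
     t * (1 - \<beta>) = 2 * q\<^sup>2 \<and> u * (1 - \<beta>) = 2 * p\<^sup>2 \<and>
     2 * (t * p) = q * (\<beta> + 1) \<and> 2 * (u * q) = p * (\<beta> + 1)"

lemma sl2_involution_imp_hom:
  assumes "sl2_involution \<beta> p q s t u"
  shows "sl2_hom \<beta> p q s t u"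
  unfolding sl2_hom_def
proof (intro conjI)
  have s: "2 * s = \<beta> - 1" and pq: "\<beta>\<^sup>2 + 4 * p * q = 1" and tu: "2 * (t * u + p * q) = \<beta> + 1"
    and t: "t * (1 - \<beta>) = 2 * q\<^sup>2" and u: "u * (1 - \<beta>) = 2 * p\<^sup>2"
    and tp: "2 * (t * p) = q * (\<beta> + 1)" and uq: "2 * (u * q) = p * (\<beta> + 1)"
    using assms by (auto simp: sl2_involution_def)
  show "t * u = s\<^sup>2 + \<beta>" using s pq tu by algebra
  show "q * u = p * (s + 1)" using s uq by algebra
  show "p * t = q * (s + 1)" using s tp by algebra
  show "s * (\<beta> + 1) = - 2 * p * q" using s pq by algebra
qed (use assms in \<open>auto simp: sl2_involution_def\<close>)

text \<open>An endomorphism whose trace is not \<open>-1\<close> must have \<open>p = q = 0\<close>, since \<open>p\<close> and \<open>q\<close> times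
  \<open>2 s - (\<beta> - 1)\<close> vanish. It is then diagonal with eigenvalues \<open>s\<^sup>2, s, s\<close> where \<open>s\<close> is a root of
  \<open>s\<^sup>3 = s\<close>, and \<open>s = -1\<close> is excluded by the trace.\<close>

lemma sl2_hom_iff:
  "sl2_hom \<beta> p q s t u \<longleftrightarrow>
     (\<beta>, p, q, s, t, u) = (0, 0, 0, 0, 0, 0) \<or>
     (\<beta>, p, q, s, t, u) = (-1, 0, 0, 1, 0, 0) \<or>
     sl2_involution \<beta> p q s t u" (is "?hom \<longleftrightarrow> ?zero \<or> ?id \<or> ?inv")
proof
  assume ?hom
  then have tu: "t * u = s\<^sup>2 + \<beta>" and qu: "q * u = p * (s + 1)" and pt: "p * t = q * (s + 1)"
    and s: "s * (\<beta> + 1) = - 2 * p * q" and t: "t * (1 - \<beta>) = 2 * q\<^sup>2" and u: "u * (1 - \<beta>) = 2 * p\<^sup>2"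
    by (auto simp: sl2_hom_def)
  show "?zero \<or> ?id \<or> ?inv"
  proof (cases "2 * s = \<beta> - 1")
    case True
    then have pq: "\<beta>\<^sup>2 + 4 * p * q = 1"
      using s by algebra
    have "2 * (t * u + p * q) = \<beta> + 1"
      using tu pq True by algebra
    moreover have "2 * (t * p) = q * (\<beta> + 1)" "2 * (u * q) = p * (\<beta> + 1)"
      using qu pt True by algebra+
    ultimately have ?inv
      using True t u pq unfolding sl2_involution_def by blast
    then show ?thesis by blast
  next
    case False
    \<comment> \<open>Multiply the equation for \<open>q * u\<close> by \<open>1 - \<beta>\<close>, then replace
      \<open>u * (1 - \<beta>)\<close> and \<open>- 2 * p * q\<close>.\<close>
    have "p * (2 * s - (\<beta> - 1)) = 0"
      using qu u s by algebra
    moreover have "q * (2 * s - (\<beta> - 1)) = 0"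
      using pt t s by algebra
    ultimately have [simp]: "p = 0" "q = 0"
      using False by auto
    have "\<beta> \<noteq> 1"
      using s False by auto
    then have [simp]: "t = 0" "u = 0"
      using t u by auto
    have \<beta>: "\<beta> = - s\<^sup>2"
      using tu by (simp add: eq_neg_iff_add_eq_0 add.commute)
    then have "s * (1 - s) * (1 + s) = 0"
      using s \<open>p = 0\<close> by algebra
    moreover have "s \<noteq> -1"
      using False \<beta> by auto
    ultimately have "s = 0 \<or> s = 1"
      by (auto simp: add_eq_0_iff)
    then show ?thesis
      using \<beta> by auto
  qed
next
  assume "?zero \<or> ?id \<or> ?inv"
  then show ?hom
    using sl2_involution_imp_hom by (auto simp: sl2_hom_def)
qed

text \<open>These are generators of \<open>I\<close> that are not linear combinations of the equations in \<open>sl2_hom\<close>.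
  Checking them on the three families of solutions is easier than exhibiting them as members
  of the ideal generated by those equations.\<close>

lemma sl2_hom_consequences:
  assumes "sl2_hom \<beta> p q s t u"
  shows "2 * (s * p) = p * (\<beta> - 1) \<and> 2 * (s * q) = q * (\<beta> - 1) \<and>
    2 * (s\<^sup>2 - p * q) = \<beta>\<^sup>2 - \<beta> \<and> 2 * (t * u - p * q) = \<beta>\<^sup>2 + \<beta> \<and>
    s * t = - q\<^sup>2 \<and> s * u = - p\<^sup>2 \<and>
    p * (\<beta>\<^sup>2 + 4 * p * q - 1) = 0 \<and> q * (\<beta>\<^sup>2 + 4 * p * q - 1) = 0 \<and>
    \<beta> * (\<beta>\<^sup>2 + 4 * p * q - 1) = 0"
proof -
  consider "(\<beta>, p, q, s, t, u) = (0, 0, 0, 0, 0, 0)" | "(\<beta>, p, q, s, t, u) = (-1, 0, 0, 1, 0, 0)"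
    | "sl2_involution \<beta> p q s t u"
    using assms sl2_hom_iff by blast
  then show ?thesis
  proof cases
    case 3
    then have s: "2 * s = \<beta> - 1" and pq: "\<beta>\<^sup>2 + 4 * p * q = 1"
      and tu: "2 * (t * u + p * q) = \<beta> + 1"
      and t: "t * (1 - \<beta>) = 2 * q\<^sup>2" and u: "u * (1 - \<beta>) = 2 * p\<^sup>2"
      by (auto simp: sl2_involution_def)
    show ?thesis
    proof (intro conjI)
      show "2 * (s\<^sup>2 - p * q) = \<beta>\<^sup>2 - \<beta>" using s pq by algebra
      show "2 * (t * u - p * q) = \<beta>\<^sup>2 + \<beta>" using tu pq by algebra
      show "s * t = - q\<^sup>2" using s t by algebra
      show "s * u = - p\<^sup>2" using s u by algebra
    qed (simp_all add: s pq)
  qed simp_all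
qed

section \<open>The zero sets\<close>

text \<open>In terms of \<open>D e\<^sub>i = \<Sum>\<^sub>j a\<^sub>i\<^sub>j e\<^sub>j\<close>, the equations say that \<open>D 1\<close> is scalar, that \<open>D\<close> maps \<open>sl\<^sub>2\<close>
  to itself, and that its restriction to \<open>sl\<^sub>2\<close> is self-adjoint for the trace form.\<close>

definition symmetric_shape :: "complex^4^4 \<Rightarrow> bool" where
  "symmetric_shape a \<longleftrightarrow>
     a$1$1 = a$4$4 \<and> a$1$4 = a$4$1 \<and> a$2$2 = a$3$3 \<and>
     a$1$2 = - a$4$2 \<and> a$3$1 = - a$4$2 \<and> a$3$4 = a$4$2 \<and>
     a$1$3 = - a$4$3 \<and> a$2$1 = - a$4$3 \<and> a$2$4 = a$4$3"

text \<open>For \<open>a\<close> of this shape, \<open>\<beta>, p, q, s, t, u\<close> are read off from the entries as follows;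
  \<open>a\<^sub>4\<^sub>4 + a\<^sub>4\<^sub>1\<close> is the scalar by which \<open>D\<close> acts on the centre, a free parameter.\<close>

abbreviation on_sl2 :: "(complex \<Rightarrow> complex \<Rightarrow> complex \<Rightarrow> complex \<Rightarrow> complex \<Rightarrow> complex \<Rightarrow> 'r)
    \<Rightarrow> complex^4^4 \<Rightarrow> 'r" where
  "on_sl2 P a \<equiv> P (a$4$1 - a$4$4) (a$4$2) (a$4$3) (a$3$3) (a$2$3) (a$3$2)"

abbreviation eval_at :: "complex^4^4 \<Rightarrow> polyA \<Rightarrow> complex" where
  "eval_at a \<equiv> poly_eval (\<lambda>(i, j). a$i$j)"

text \<open>The nonlinear generators depend on \<open>a\<^sub>4\<^sub>1\<close> and \<open>a\<^sub>4\<^sub>4\<close> only through \<open>\<beta>\<close>, that is, not on the central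
  scalar. In particular the cubic \<open>f23\<close> is \<open>\<beta>\<close> times \<open>g3\<close>.\<close>

lemma eval_generators:
  fixes a :: "complex^4^4"
  defines "\<beta> \<equiv> a$4$1 - a$4$4" and "p \<equiv> a$4$2" and "q \<equiv> a$4$3"
    and "s \<equiv> a$3$3" and "t \<equiv> a$2$3" and "u \<equiv> a$3$2"
  shows "eval_at a f2 = t * u - p * q - (\<beta>\<^sup>2 + \<beta>) / 2"
    "eval_at a f4 = 2 * q\<^sup>2 - t * (1 - \<beta>)"
    "eval_at a f6 = t * p - q * (\<beta> + 1) / 2"
    "eval_at a f8 = 2 * p\<^sup>2 - u * (1 - \<beta>)"
    "eval_at a f10 = u * q - p * (\<beta> + 1) / 2"
    "eval_at a f12 = s\<^sup>2 - p * q - (\<beta>\<^sup>2 - \<beta>) / 2"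
    "eval_at a f13 = s * t + q\<^sup>2"
    "eval_at a f14 = s * (\<beta> + 1) + 2 * p * q"
    "eval_at a f16 = s * p - p * (\<beta> - 1) / 2"
    "eval_at a f18 = s * q - q * (\<beta> - 1) / 2"
    "eval_at a f19 = s * u + p\<^sup>2"
    "eval_at a f20 = p * (\<beta>\<^sup>2 + 4 * p * q - 1)"
    "eval_at a f22 = q * (\<beta>\<^sup>2 + 4 * p * q - 1)"
    "eval_at a f23 = \<beta> * (\<beta>\<^sup>2 + 4 * p * q - 1)"
    "eval_at a g1 = a$2$2 - (\<beta> - 1) / 2"
    "eval_at a g2 = t * u + p * q - (\<beta> + 1) / 2"
    "eval_at a g3 = \<beta>\<^sup>2 + 4 * p * q - 1"
  unfolding \<beta>_def p_def q_def s_def t_def u_def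
  by (simp_all add: f2_def f4_def f6_def f8_def f10_def f12_def f13_def f14_def f16_def f18_def
      f19_def f20_def f22_def f23_def g1_def g2_def g3_def poly_\<beta>_def
      field_simps power2_eq_square power3_eq_cube)

lemma eq_half_iff: "x = y / 2 \<longleftrightarrow> 2 * x = y" for x y :: complex
  by (auto simp: field_simps)

lemma generators_vanish_iff:
  fixes a :: "complex^4^4"
  defines "\<beta> \<equiv> a$4$1 - a$4$4" and "p \<equiv> a$4$2" and "q \<equiv> a$4$3"
    and "s \<equiv> a$3$3" and "t \<equiv> a$2$3" and "u \<equiv> a$3$2"
  shows "eval_at a f2 = 0 \<longleftrightarrow> 2 * (t * u - p * q) = \<beta>\<^sup>2 + \<beta>"
    "eval_at a f4 = 0 \<longleftrightarrow> t * (1 - \<beta>) = 2 * q\<^sup>2"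
    "eval_at a f6 = 0 \<longleftrightarrow> 2 * (t * p) = q * (\<beta> + 1)"
    "eval_at a f8 = 0 \<longleftrightarrow> u * (1 - \<beta>) = 2 * p\<^sup>2"
    "eval_at a f10 = 0 \<longleftrightarrow> 2 * (u * q) = p * (\<beta> + 1)"
    "eval_at a f12 = 0 \<longleftrightarrow> 2 * (s\<^sup>2 - p * q) = \<beta>\<^sup>2 - \<beta>"
    "eval_at a f13 = 0 \<longleftrightarrow> s * t = - q\<^sup>2"
    "eval_at a f14 = 0 \<longleftrightarrow> s * (\<beta> + 1) = - (2 * p * q)"
    "eval_at a f16 = 0 \<longleftrightarrow> 2 * (s * p) = p * (\<beta> - 1)"
    "eval_at a f18 = 0 \<longleftrightarrow> 2 * (s * q) = q * (\<beta> - 1)"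
    "eval_at a f19 = 0 \<longleftrightarrow> s * u = - p\<^sup>2"
    "eval_at a f20 = 0 \<longleftrightarrow> p * (\<beta>\<^sup>2 + 4 * p * q - 1) = 0"
    "eval_at a f22 = 0 \<longleftrightarrow> q * (\<beta>\<^sup>2 + 4 * p * q - 1) = 0"
    "eval_at a f23 = 0 \<longleftrightarrow> \<beta> * (\<beta>\<^sup>2 + 4 * p * q - 1) = 0"
    "eval_at a g1 = 0 \<longleftrightarrow> 2 * a$2$2 = \<beta> - 1"
    "eval_at a g2 = 0 \<longleftrightarrow> 2 * (t * u + p * q) = \<beta> + 1"
    "eval_at a g3 = 0 \<longleftrightarrow> \<beta>\<^sup>2 + 4 * p * q = 1"
  unfolding \<beta>_def p_def q_def s_def t_def u_def eval_generators
    right_minus_eq add_eq_0_iff2 eq_half_iff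
  by (rule refl eq_commute)+

lemma linear_generators_vanish_iff:
  "symmetric_shape a \<longleftrightarrow>
     (\<forall>f\<in>{f1, f3, f5, f7, f9, f11, f15, f17, f21}. eval_at a f = 0)"
  by (auto simp: symmetric_shape_def f1_def f3_def f5_def f7_def f9_def f11_def f15_def f17_def
      f21_def eq_neg_iff_add_eq_0)

lemma zero_set_p1:
  "transpose a \<in> zero_set ideal_p1 \<longleftrightarrow> symmetric_shape a \<and>
     on_sl2 (\<lambda>\<beta> p q s t u. (\<beta>, p, q, s, t, u)) a = (0, 0, 0, 0, 0, 0)"
  unfolding ideal_p1_def zero_set_ideal_gen symmetric_shape_def
  by (auto simp: f1_def poly_\<alpha>_def poly_\<beta>_def)

lemma zero_set_p2:
  "transpose a \<in> zero_set ideal_p2 \<longleftrightarrow> symmetric_shape a \<and>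
     on_sl2 (\<lambda>\<beta> p q s t u. (\<beta>, p, q, s, t, u)) a = (-1, 0, 0, 1, 0, 0)"
proof -
  have "x - y + 1 = 0 \<longleftrightarrow> x = y - 1" "x - y = -1 \<longleftrightarrow> x = y - 1" for x y :: complex
    by (auto simp: algebra_simps eq_neg_iff_add_eq_0)
  then show ?thesis
    unfolding ideal_p2_def zero_set_ideal_gen symmetric_shape_def
    by (auto simp: f1_def poly_\<alpha>_def poly_\<beta>_def)
qed

lemma zero_set_p3:
  "transpose a \<in> zero_set ideal_p3 \<longleftrightarrow> symmetric_shape a \<and> on_sl2 sl2_involution a"
proof -
  have "transpose a \<in> zero_set ideal_p3 \<longleftrightarrow> symmetric_shape a \<and>
      (\<forall>f\<in>{f4, f6, f8, f10, g1, g2, g3}. eval_at a f = 0)"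
    unfolding ideal_p3_def zero_set_ideal_gen linear_generators_vanish_iff by auto
  also have "\<dots> \<longleftrightarrow> symmetric_shape a \<and> on_sl2 sl2_involution a"
    unfolding ball_simps generators_vanish_iff sl2_involution_def symmetric_shape_def
    by (auto simp only:)
  finally show ?thesis .
qed

lemma zero_set_I:
  "transpose a \<in> zero_set ideal_I \<longleftrightarrow> symmetric_shape a \<and> on_sl2 sl2_hom a"
proof -
  define \<beta> p q s t u where coords: "\<beta> = a$4$1 - a$4$4" "p = a$4$2" "q = a$4$3"
    "s = a$3$3" "t = a$2$3" "u = a$3$2"
  let ?F = "{f2, f4, f6, f8, f10, f12, f13, f14, f16, f18, f19, f20, f22, f23}"
  note vanish = generators_vanish_iff[of a, folded coords]
  have "transpose a \<in> zero_set ideal_I \<longleftrightarrow> symmetric_shape a \<and> (\<forall>f\<in>?F. eval_at a f = 0)"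
    unfolding ideal_I_def zero_set_ideal_gen linear_generators_vanish_iff by auto
  also have "(\<forall>f\<in>?F. eval_at a f = 0) \<longleftrightarrow> sl2_hom \<beta> p q s t u"
  proof
    assume "\<forall>f\<in>?F. eval_at a f = 0"
    then have tu: "2 * (t * u - p * q) = \<beta>\<^sup>2 + \<beta>" "2 * (s\<^sup>2 - p * q) = \<beta>\<^sup>2 - \<beta>"
      and p: "2 * (s * p) = p * (\<beta> - 1)" "2 * (u * q) = p * (\<beta> + 1)"
      and q: "2 * (s * q) = q * (\<beta> - 1)" "2 * (t * p) = q * (\<beta> + 1)"
      and s: "s * (\<beta> + 1) = - (2 * p * q)"
      and "t * (1 - \<beta>) = 2 * q\<^sup>2" "u * (1 - \<beta>) = 2 * p\<^sup>2"
      unfolding ball_simps vanish by blast+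
    moreover have "t * u = s\<^sup>2 + \<beta>"
      using tu by algebra
    moreover have "q * u = p * (s + 1)"
      using p by algebra
    moreover have "p * t = q * (s + 1)"
      using q by algebra
    ultimately show "sl2_hom \<beta> p q s t u"
      by (simp add: sl2_hom_def)
  next
    assume hom: "sl2_hom \<beta> p q s t u"
    note conseq = sl2_hom_consequences[OF hom]
    then have sp: "2 * (s * p) = p * (\<beta> - 1)" and sq: "2 * (s * q) = q * (\<beta> - 1)"
      by blast+
    have "t * (1 - \<beta>) = 2 * q\<^sup>2" "u * (1 - \<beta>) = 2 * p\<^sup>2" "s * (\<beta> + 1) = - (2 * p * q)"
      and pt: "p * t = q * (s + 1)" and qu: "q * u = p * (s + 1)"
      using hom by (simp_all add: sl2_hom_def)
    moreover have "2 * (t * p) = q * (\<beta> + 1)"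
      using pt sq by algebra
    moreover have "2 * (u * q) = p * (\<beta> + 1)"
      using qu sp by algebra
    ultimately show "\<forall>f\<in>?F. eval_at a f = 0"
      unfolding ball_simps vanish using conseq by blast
  qed
  finally show ?thesis
    by (simp add: coords)
qed

section \<open>Linear endomorphisms of the Lie algebra of matrices\<close>

definition gl2_coord :: "complex^2^2 \<Rightarrow> 4 \<Rightarrow> complex" where
  "gl2_coord x i = (if i = 1 then x$1$1 else if i = 2 then x$1$2
                    else if i = 3 then x$2$1 else x$2$2)"

text \<open>The linear map with \<open>e\<^sub>i \<mapsto> \<Sum>\<^sub>j a\<^sub>i\<^sub>j e\<^sub>j\<close>, so that \<open>a\<close> is the transpose of its matrix.\<close>

definition gl2_map :: "complex^4^4 \<Rightarrow> complex^2^2 \<Rightarrow> complex^2^2" where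
  "gl2_map a x =
     (\<Sum>i\<in>UNIV. mat_scale (gl2_coord x i) (\<Sum>j\<in>UNIV. mat_scale (a$i$j) (gl2_basis j)))"

lemma gl2_map_entries:
  "gl2_map a x $ 1 $ 1 = x$1$1 * a$1$1 + x$1$2 * a$2$1 + x$2$1 * a$3$1 + x$2$2 * a$4$1"
  "gl2_map a x $ 1 $ 2 = x$1$1 * a$1$2 + x$1$2 * a$2$2 + x$2$1 * a$3$2 + x$2$2 * a$4$2"
  "gl2_map a x $ 2 $ 1 = x$1$1 * a$1$3 + x$1$2 * a$2$3 + x$2$1 * a$3$3 + x$2$2 * a$4$3"
  "gl2_map a x $ 2 $ 2 = x$1$1 * a$1$4 + x$1$2 * a$2$4 + x$2$1 * a$3$4 + x$2$2 * a$4$4"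
  by (simp_all add: gl2_map_def gl2_coord_def gl2_basis_def sum_4 mat_scale_def mat_unit_def)

lemma linear_gl2_map: "Vector_Spaces.linear mat_scale mat_scale (gl2_map a)"
  by unfold_locales
     (simp_all add: vec_eq_iff forall_2 gl2_map_entries mat_scale_def algebra_simps)

lemma gl2_expand: "x = (\<Sum>i\<in>UNIV. mat_scale (gl2_coord x i) (gl2_basis i))"
  by (simp add: vec_eq_iff forall_2 gl2_coord_def gl2_basis_def sum_4 mat_scale_def mat_unit_def)

lemma gl2_map_unique:
  assumes "Vector_Spaces.linear mat_scale mat_scale D"
    and "\<And>i. D (gl2_basis i) = (\<Sum>j\<in>UNIV. mat_scale (a$i$j) (gl2_basis j))"
  shows "D = gl2_map a"
proof
  fix x
  interpret D: Vector_Spaces.linear mat_scale mat_scale D by (rule assms)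
  have "D x = D (\<Sum>i\<in>UNIV. mat_scale (gl2_coord x i) (gl2_basis i))"
    by (simp flip: gl2_expand)
  also have "\<dots> = gl2_map a x"
    by (simp add: D.sum D.scale assms(2) gl2_map_def)
  finally show "D x = gl2_map a x" .
qed

lemma gl2_map_basis: "gl2_map a (gl2_basis i) = (\<Sum>j\<in>UNIV. mat_scale (a$i$j) (gl2_basis j))"
proof -
  have "gl2_coord (gl2_basis i) k = (if k = i then 1 else 0)" for k
    using exhaust_4[of i] exhaust_4[of k]
    by (auto simp: gl2_coord_def gl2_basis_def mat_unit_def)
  moreover have "mat_scale 0 y = 0" "mat_scale 1 y = y" for y :: "complex^2^2"
    by (simp_all add: mat_scale_def vec_eq_iff)
  ultimately show ?thesis
    by (simp add: gl2_map_def if_distrib[of "\<lambda>c. mat_scale c _"] cong: if_cong)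
qed

text \<open>By uniqueness of the linear extension, the existential quantifier over \<open>D\<close> in the definition of
  \<open>as_matrices\<close> can only be witnessed by \<open>gl2_map a\<close>.\<close>

lemma as_matrices_iff:
  assumes "\<And>D. D \<in> S \<Longrightarrow> Vector_Spaces.linear mat_scale mat_scale D"
  shows "transpose a \<in> as_matrices S \<longleftrightarrow> gl2_map a \<in> S"
proof
  assume "transpose a \<in> as_matrices S"
  then obtain D where "D \<in> S"
    "\<forall>i. D (gl2_basis i) = (\<Sum>j\<in>UNIV. mat_scale (a$i$j) (gl2_basis j))"
    by (auto simp: as_matrices_def)
  then show "gl2_map a \<in> S"
    using gl2_map_unique[of D a] assms by simp
next
  assume "gl2_map a \<in> S"
  then show "transpose a \<in> as_matrices S"
    unfolding as_matrices_def using gl2_map_basis by blast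
qed

section \<open>Multiplicative Hom-Lie structures\<close>

lemma commutator_entries:
  fixes x y :: "complex^2^2"
  shows "commutator x y $ 1 $ 1 = x$1$2 * y$2$1 - x$2$1 * y$1$2"
    "commutator x y $ 1 $ 2 = (x$1$1 - x$2$2) * y$1$2 - x$1$2 * (y$1$1 - y$2$2)"
    "commutator x y $ 2 $ 1 = x$2$1 * (y$1$1 - y$2$2) - (x$1$1 - x$2$2) * y$2$1"
    "commutator x y $ 2 $ 2 = x$2$1 * y$1$2 - x$1$2 * y$2$1"
  by (simp_all add: commutator_def matrix_matrix_mult_def sum_2 algebra_simps)

text \<open>The equations are the entries of finitely many instances: the Hom-Jacobi identity with the
  unit matrix and with the standard basis of \<open>sl\<^sub>2\<close>, and multiplicativity on pairs of matrix units.\<close>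

lemma gl2_map_HLie_m_imp:
  assumes "gl2_map a \<in> gl.HLie\<^sub>m"
  shows "symmetric_shape a \<and> on_sl2 sl2_hom a"
proof -
  let ?D = "gl2_map a"
  let ?E = "mat_unit :: 2 \<Rightarrow> 2 \<Rightarrow> complex^2^2"
  note entries = gl2_map_entries commutator_entries mat_unit_def
  have hom_lie: "(commutator (?D x) (commutator y z) + commutator (?D y) (commutator z x)
      + commutator (?D z) (commutator x y)) $ i $ j = 0" for x y z i j
    using assms by (simp add: gl.HLie\<^sub>m_def gl.HLie_def)
  have mult: "?D (commutator x y) $ i $ j = commutator (?D x) (?D y) $ i $ j" for x y i j
    using assms by (simp add: gl.HLie\<^sub>m_def)
  \<comment> \<open>\<open>D 1\<close> commutes with \<open>e\<^sub>2 = [e\<^sub>1, e\<^sub>2]\<close> and \<open>-e\<^sub>3 = [e\<^sub>1, e\<^sub>3]\<close>.\<close>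
  have central: "a$1$1 + a$4$1 = a$1$4 + a$4$4" "a$4$2 = - a$1$2" "a$4$3 = - a$1$3"
    using hom_lie[of "?E 1 1 + ?E 2 2" "?E 1 1" "?E 1 2" 1 2]
      hom_lie[of "?E 1 1 + ?E 2 2" "?E 1 1" "?E 2 1" 1 1]
      hom_lie[of "?E 1 1 + ?E 2 2" "?E 1 1" "?E 1 2" 1 1]
    by (simp_all add: entries algebra_simps)
  \<comment> \<open>Images of commutators are commutators, hence have trace zero.\<close>
  have trace: "?D (commutator x y) $ 1 $ 1 + ?D (commutator x y) $ 2 $ 2 = 0" for x y
    unfolding mult by (simp add: commutator_entries)
  have traceless: "a$2$1 + a$2$4 = 0" "a$3$1 + a$3$4 = 0" "a$1$1 - a$4$1 + (a$1$4 - a$4$4) = 0"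
    using trace[of "?E 1 1" "?E 1 2"] trace[of "?E 2 1" "?E 1 1"] trace[of "?E 1 2" "?E 2 1"]
    by (simp_all add: entries algebra_simps)
  \<comment> \<open>The identity for the triple \<open>e\<^sub>2, e\<^sub>3, h\<close> amounts to self-adjointness on \<open>sl\<^sub>2\<close>.\<close>
  have symmetric: "a$2$2 = a$3$3" "2 * a$2$4 + 2 * a$1$3 = 2 * a$2$1 + 2 * a$4$3"
    "2 * a$3$1 + 2 * a$4$2 = 2 * a$3$4 + 2 * a$1$2"
    using hom_lie[of "?E 1 2" "?E 2 1" "?E 1 1 - ?E 2 2" 1 1]
      hom_lie[of "?E 1 2" "?E 2 1" "?E 1 1 - ?E 2 2" 2 1]
      hom_lie[of "?E 1 2" "?E 2 1" "?E 1 1 - ?E 2 2" 1 2]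
    by (simp_all add: entries algebra_simps)
  have "a$1$1 = a$4$4" "a$1$4 = a$4$1" "a$2$4 = a$4$3" "a$3$4 = a$4$2"
    "a$2$1 = - a$4$3" "a$3$1 = - a$4$2"
    using central traceless symmetric by algebra+
  with central symmetric have shape: "a$1$1 = a$4$4" "a$1$4 = a$4$1" "a$2$2 = a$3$3"
     "a$1$2 = - a$4$2" "a$3$1 = - a$4$2" "a$3$4 = a$4$2"
     "a$1$3 = - a$4$3" "a$2$1 = - a$4$3" "a$2$4 = a$4$3"
    by simp_all
  define \<beta> p q s t u where coords: "\<beta> = a$4$1 - a$4$4" "p = a$4$2" "q = a$4$3"
    "s = a$3$3" "t = a$2$3" "u = a$3$2"
  have tu: "t * u = s\<^sup>2 + \<beta>"
    and qu: "2 * (q * u) = 2 * p + 2 * (s * p)" and pt: "2 * (p * t) = 2 * q + 2 * (s * q)"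
    using mult[of "?E 1 2" "?E 2 1" 1 1] mult[of "?E 1 2" "?E 2 1" 1 2] mult[of "?E 1 2" "?E 2 1" 2 1]
    by (simp_all add: entries shape coords algebra_simps power2_eq_square)
  moreover have "q * u = p * (s + 1)" "p * t = q * (s + 1)"
    using qu pt by algebra+
  moreover have "s * (\<beta> + 1) = - 2 * p * q" "t * (1 - \<beta>) = 2 * q\<^sup>2" "u * (1 - \<beta>) = 2 * p\<^sup>2"
    using mult[of "?E 1 1" "?E 1 2" 1 2] mult[of "?E 1 1" "?E 1 2" 2 1] mult[of "?E 2 1" "?E 1 1" 1 2]
    by (simp_all add: entries shape coords algebra_simps power2_eq_square)
  ultimately have "sl2_hom \<beta> p q s t u"
    by (simp add: sl2_hom_def)
  moreover have "symmetric_shape a"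
    by (simp add: symmetric_shape_def shape)
  ultimately show ?thesis
    by (simp add: coords)
qed

text \<open>Both identities are multilinear, so their entries are polynomial identities in the entries of arbitrary
  matrices: the shape gives the Hom-Jacobi identity, and together with \<open>sl2_hom\<close> multiplicativity.\<close>

lemma gl2_map_HLie_m:
  assumes "symmetric_shape a" "on_sl2 sl2_hom a"
  shows "gl2_map a \<in> gl.HLie\<^sub>m"
proof -
  let ?D = "gl2_map a"
  have shape: "a$1$1 = a$4$4" "a$1$4 = a$4$1" "a$2$2 = a$3$3"
     "a$1$2 = - a$4$2" "a$3$1 = - a$4$2" "a$3$4 = a$4$2"
     "a$1$3 = - a$4$3" "a$2$1 = - a$4$3" "a$2$4 = a$4$3"
    using assms(1) by (simp_all add: symmetric_shape_def)
  have "commutator (?D x) (commutator y z) + commutator (?D y) (commutator z x)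
      + commutator (?D z) (commutator x y) = 0" for x y z
    by (simp add: vec_eq_iff forall_2 gl2_map_entries commutator_entries shape)
       (simp add: algebra_simps)
  moreover have "?D (commutator x y) = commutator (?D x) (?D y)" for x y
    using assms(2)
    by (simp add: vec_eq_iff forall_2 gl2_map_entries commutator_entries shape sl2_hom_def,
        intro conjI) algebra+
  ultimately show ?thesis
    using linear_gl2_map by (simp add: gl.HLie\<^sub>m_def gl.HLie_def)
qed

theorem theorem2p10:
  shows "as_matrices gl.HLie\<^sub>m = zero_set ideal_I \<and>
    zero_set ideal_I = zero_set ideal_p1 \<union> zero_set ideal_p2 \<union> zero_set ideal_p3"
proof -
  have eq_by_transposes: "A = B" if "\<And>a. transpose a \<in> A \<longleftrightarrow> transpose a \<in> B" for A B :: "(complex^4^4) set"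
    using that by (metis set_eqI transpose_transpose)
  have "gl2_map a \<in> gl.HLie\<^sub>m \<longleftrightarrow> symmetric_shape a \<and> on_sl2 sl2_hom a" for a
    using gl2_map_HLie_m_imp gl2_map_HLie_m by blast
  moreover have "transpose a \<in> as_matrices gl.HLie\<^sub>m \<longleftrightarrow> gl2_map a \<in> gl.HLie\<^sub>m" for a
    by (rule as_matrices_iff) (simp add: gl.HLie\<^sub>m_def gl.HLie_def)
  ultimately have "as_matrices gl.HLie\<^sub>m = zero_set ideal_I"
    by (intro eq_by_transposes) (simp add: zero_set_I)
  moreover have "zero_set ideal_I = zero_set ideal_p1 \<union> zero_set ideal_p2 \<union> zero_set ideal_p3"
    by (intro eq_by_transposes) (auto simp: zero_set_I zero_set_p1 zero_set_p2 zero_set_p3 sl2_hom_iff)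
  ultimately show ?thesis ..
qed

end
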